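(* Let $F$ be a field of characteristic not $2$, let $K/F$ be a finite field extension, let $\sigma\in\mathrm{Aut}_F(K)$ be non-trivial and let $c\in K^{\times}$. Then every $F$-algebra automorphism $G$ of $D(K,\sigma,c)$ is of the form $$G(u,v)=(\tau(u),\tau(v)b)\qquad(u,v\in K)$$ for some $\tau\in\mathrm{Aut}_F(K)$ such that $\tau$ and $\sigma$ commute and some $b\in K^{\times}$ satisfying $\tau(c)=c\,\sigma(b^2)$. Conversely, every map of this form, with $\tau\in \mathrm{Aut}_F(K)$ and $b\in K^{\times}$ satisfying these conditions, is an $F$-algebra automorphism of $D(K,\sigma,c)$.
   Context: $D(K,\sigma,c)$ denotes the $F$-vector space $K\oplus K$ with multiplication $(u,v)(x,y)=(ux+c\,\sigma(vy),\,uy+vx)$ for $u,v,x,y\in K$; it is a unital commutative, not necessarily associative, $F$-algebra. *)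

theory Defs
  imports Complex_Main "HOL-Library.Product_Plus"
begin

text \<open>
  A field extension is given by a homomorphism \<open>\<iota>\<close> embedding the base field \<open>'f\<close> into \<open>'k\<close>;
  it makes \<open>'k\<close> an \<open>'f\<close>-vector space via \<open>a \<cdot> x = \<iota> a * x\<close>.
\<close>

locale field_extension =
  fixes \<iota> :: "'f::field \<Rightarrow> 'k::field"
  assumes emb_one: "\<iota> 1 = 1"
    and emb_add: "\<iota> (a + b) = \<iota> a + \<iota> b"
    and emb_mult: "\<iota> (a * b) = \<iota> a * \<iota> b"

locale finite_field_extension = field_extension +
  assumes finite_degree: "\<exists>B. finite B \<and> module.span (\<lambda>a x. \<iota> a * x) B = UNIV"

definition Aut_over :: "('f::field \<Rightarrow> 'k::field) \<Rightarrow> ('k \<Rightarrow> 'k) set" where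
  "Aut_over \<iota> = {\<tau>. bij \<tau> \<and> (\<forall>x y. \<tau> (x + y) = \<tau> x + \<tau> y) \<and>
     (\<forall>x y. \<tau> (x * y) = \<tau> x * \<tau> y) \<and> (\<forall>a. \<tau> (\<iota> a) = \<iota> a)}"

text \<open>
  Automorphisms of a not necessarily associative algebra with scalar multiplication \<open>s\<close> and
  product \<open>m\<close>. If there is a unit, it is preserved because \<open>G\<close> is bijective and multiplicative.
\<close>

definition algebra_automorphism ::
  "('f::field \<Rightarrow> 'a::ab_group_add \<Rightarrow> 'a) \<Rightarrow> ('a \<Rightarrow> 'a \<Rightarrow> 'a) \<Rightarrow> ('a \<Rightarrow> 'a) \<Rightarrow> bool" where
  "algebra_automorphism s m G \<longleftrightarrow>
     Vector_Spaces.linear s s G \<and> bij G \<and> (\<forall>p q. G (m p q) = m (G p) (G q))"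

text \<open>
  The algebra \<open>D(K,\<sigma>,c)\<close> lives on the type \<open>'k \<times> 'k\<close> with componentwise addition.
\<close>

definition D_scale :: "('f::field \<Rightarrow> 'k::field) \<Rightarrow> 'f \<Rightarrow> 'k \<times> 'k \<Rightarrow> 'k \<times> 'k" where
  "D_scale \<iota> a = (\<lambda>(u, v). (\<iota> a * u, \<iota> a * v))"

definition D_mult :: "('k::field \<Rightarrow> 'k) \<Rightarrow> 'k \<Rightarrow> 'k \<times> 'k \<Rightarrow> 'k \<times> 'k \<Rightarrow> 'k \<times> 'k" where
  "D_mult \<sigma> c = (\<lambda>(u, v) (x, y). (u * x + c * \<sigma> (v * y), u * y + v * x))"

end

theory Submission
  imports Defs
begin

text \<open>
  The middle nucleus of \<open>D(K,\<sigma>,c)\<close> is \<open>K \<times> 0\<close> because \<open>\<sigma> \<noteq> id\<close>, so an automorphism \<open>G\<close> restricts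
  to some \<open>\<tau>\<close> on it. With \<open>G (0, 1) = (a, b)\<close> one has \<open>G (u, v) = (\<tau> u, 0) + (\<tau> v, 0) (a, b)\<close>.
  Squaring \<open>(0, 1)\<close> gives \<open>2 a b = 0\<close>, hence \<open>a = 0\<close> (\<open>b \<noteq> 0\<close> as \<open>(0, 1)\<close> is not in the middle nucleus), and
  \<open>\<tau> c = c \<sigma>(b\<^sup>2)\<close>; the product \<open>(0, v) (0, 1) = (c \<sigma>(v), 0)\<close> then shows that \<open>\<tau>\<close> and \<open>\<sigma>\<close> commute.
\<close>

definition middle_nucleus :: "('a \<Rightarrow> 'a \<Rightarrow> 'a) \<Rightarrow> 'a set" where
  "middle_nucleus m = {q. \<forall>p r. m (m p q) r = m p (m q r)}"

text \<open>Injectivity of \<open>G\<close> makes the associativity equation for \<open>p\<close>,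
  \<open>q\<close>, \<open>r\<close> equivalent to that for their images; surjectivity lets
  \<open>G p\<close> and \<open>G r\<close> range over everything.\<close>

lemma bij_mult_middle_nucleus_iff:
  assumes "bij G" "\<And>p q. G (m p q) = m (G p) (G q)"
  shows "G q \<in> middle_nucleus m \<longleftrightarrow> q \<in> middle_nucleus m"
proof -
  have "m (m (G p) (G q)) (G r) = m (G p) (m (G q) (G r)) \<longleftrightarrow> m (m p q) r = m p (m q r)" for p r
    using assms(1) by (simp add: bij_def inj_eq flip: assms(2))
  moreover have "surj G"
    using assms(1) by (rule bij_is_surj)
  ultimately show ?thesis
    unfolding middle_nucleus_def mem_Collect_eq by (metis surjD)
qed

lemma middle_nucleus_D_mult:
  fixes \<sigma> :: "'k::field \<Rightarrow> 'k"
  assumes mult: "\<And>x y. \<sigma> (x * y) = \<sigma> x * \<sigma> y" and zero: "\<And>x. \<sigma> x = 0 \<longleftrightarrow> x = 0"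
    and one: "\<sigma> 1 = 1"
    and nontriv: "\<sigma> \<noteq> id" and c: "c \<noteq> 0"
  shows "middle_nucleus (D_mult \<sigma> c) = range (\<lambda>u. (u, 0))"
proof (intro set_eqI iffI)
  fix q assume q: "q \<in> middle_nucleus (D_mult \<sigma> c)"
  obtain w z where wz: "q = (w, z)" by fastforce
  have "z = 0"
  proof (rule ccontr)
    assume "z \<noteq> 0"
    have "\<sigma> v = v" for v
    proof -
      \<comment> \<open>These outer factors isolate \<open>z\<close>: the first components of both
        sides agree, and the second ones are \<open>c * \<sigma> (v * z)\<close> and
        \<open>v * (c * \<sigma> z)\<close>.\<close>
      have "D_mult \<sigma> c (D_mult \<sigma> c (0, v) q) (0, 1) = D_mult \<sigma> c (0, v) (D_mult \<sigma> c q (0, 1))"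
        using q by (simp add: middle_nucleus_def)
      then have "c * \<sigma> z * \<sigma> v = c * \<sigma> z * v"
        by (simp add: D_mult_def wz mult one mult_ac)
      then show ?thesis using c zero \<open>z \<noteq> 0\<close> by simp
    qed
    then show False using nontriv by auto
  qed
  then show "q \<in> range (\<lambda>u. (u, 0))" using wz by simp
next
  \<comment> \<open>Multiplying by \<open>(u, 0)\<close> on either side scales both components by
    \<open>u\<close>, and \<open>\<sigma>\<close> is applied only to the product of second
    components, so \<open>u\<close> may sit in either factor.\<close>
  fix q :: "'k \<times> 'k" assume "q \<in> range (\<lambda>u. (u, 0))"
  moreover have "\<sigma> 0 = 0" using zero by simp
  ultimately show "q \<in> middle_nucleus (D_mult \<sigma> c)"
    by (auto simp: middle_nucleus_def D_mult_def algebra_simps mult)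
qed

lemma Aut_overD:
  assumes "\<tau> \<in> Aut_over \<iota>"
  shows "bij \<tau>" "\<tau> (x + y) = \<tau> x + \<tau> y" "\<tau> (x * y) = \<tau> x * \<tau> y" "\<tau> (\<iota> a) = \<iota> a"
    "\<tau> 0 = 0" "\<tau> x = 0 \<longleftrightarrow> x = 0" "\<tau> 1 = 1"
proof -
  show 1: "bij \<tau>" "\<tau> (x + y) = \<tau> x + \<tau> y" "\<tau> (x * y) = \<tau> x * \<tau> y" "\<tau> (\<iota> a) = \<iota> a"
    using assms by (auto simp: Aut_over_def)
  have "\<tau> (0 + 0) = \<tau> 0 + \<tau> 0"
    using assms unfolding Aut_over_def by blast
  then show "\<tau> 0 = 0" by (metis add_0_right add_left_cancel)
  then show "\<tau> x = 0 \<longleftrightarrow> x = 0"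
    using 1(1) by (metis bij_pointE)
  show "\<tau> 1 = 1"
    using assms unfolding Aut_over_def by (auto simp: bij_def) (metis mult_1 mult_1_right surjD)
qed

context field_extension
begin

lemma emb_eq_0_iff: "\<iota> a = 0 \<longleftrightarrow> a = 0"
proof
  show "a = 0" if "\<iota> a = 0"
    using that emb_mult[of a "inverse a"] emb_one by (cases "a = 0") auto
  show "\<iota> a = 0" if "a = 0"
    using that emb_add[of 0 0] by (metis add_0_right add_left_cancel)
qed

text \<open>The hypothesis concerns the base field, but the factor 2 in
  \<open>2 * (a * b) = 0\<close> is to be cancelled in the extension; the trivial kernel of
  \<open>\<iota>\<close> bridges the two.\<close>

lemma two_neq_0:
  assumes "CHAR('f) \<noteq> 2"
  shows "(2 :: 'k) \<noteq> 0"
proof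
  assume "(2 :: 'k) = 0"
  then have "\<iota> 2 = 0"
    using emb_add[of 1 1] emb_one by simp
  then have "of_nat 2 = (0 :: 'f)"
    by (simp add: emb_eq_0_iff)
  then have "CHAR('f) dvd 2"
    unfolding of_nat_eq_0_iff_char_dvd .
  moreover from this have "CHAR('f) \<le> 2" "CHAR('f) \<noteq> 0"
    by (simp add: dvd_imp_le, metis dvd_0_left_iff zero_neq_numeral)
  moreover have "CHAR('f) \<noteq> 1"
    by simp
  ultimately show False
    using assms by linarith
qed

lemma vector_space_D_scale: "vector_space (D_scale \<iota>)"
  by unfold_locales
    (auto simp: D_scale_def emb_add emb_mult emb_one algebra_simps split: prod.splits)

lemma linear_D_scale_iff:
  "Vector_Spaces.linear (D_scale \<iota>) (D_scale \<iota>) G \<longleftrightarrow>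
    (\<forall>p q. G (p + q) = G p + G q) \<and> (\<forall>a p. G (D_scale \<iota> a p) = D_scale \<iota> a (G p))"
  using vector_space_D_scale
  by (auto simp: Vector_Spaces.linear_def module_hom_def module_hom_axioms_def
      vector_space_def module_def)

text \<open>Only the term with \<open>\<sigma>\<close> in the product needs the conditions on
  \<open>b\<close>: commutation moves \<open>\<tau>\<close> inside \<open>\<sigma>\<close>, and
  \<open>\<tau> c\<close> supplies one factor \<open>b\<close> for each second component.\<close>

lemma algebra_automorphism_if:
  assumes \<sigma>: "\<sigma> \<in> Aut_over \<iota>" and \<tau>: "\<tau> \<in> Aut_over \<iota>"
    and comm: "\<tau> \<circ> \<sigma> = \<sigma> \<circ> \<tau>" and b: "b \<noteq> 0" and \<tau>c: "\<tau> c = c * \<sigma> (b\<^sup>2)"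
  shows "algebra_automorphism (D_scale \<iota>) (D_mult \<sigma> c) (\<lambda>(u, v). (\<tau> u, \<tau> v * b))"
proof -
  note \<tau>D = Aut_overD[OF \<tau>]
  have "bij (\<lambda>(u, v). (\<tau> u, \<tau> v * b))"
  proof (rule bij_betw_byWitness[where f' = "\<lambda>(x, y). (inv \<tau> x, inv \<tau> (y / b))"])
  qed (use b \<tau>D(1) in \<open>auto simp: bij_is_inj bij_is_surj surj_f_inv_f\<close>)
  moreover have "\<tau> (\<sigma> x) = \<sigma> (\<tau> x)" for x
    using comm by (metis comp_apply)
  then have "\<tau> (c * \<sigma> (v * y)) = c * \<sigma> (\<tau> v * b * (\<tau> y * b))" for v y
    by (simp add: \<tau>D \<tau>c Aut_overD(3)[OF \<sigma>] power2_eq_square mult_ac)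
  ultimately show ?thesis
    by (auto simp: algebra_automorphism_def linear_D_scale_iff D_scale_def D_mult_def
        \<tau>D algebra_simps)
qed

lemma algebra_automorphism_imp:
  assumes char: "CHAR('f) \<noteq> 2" and \<sigma>: "\<sigma> \<in> Aut_over \<iota>" "\<sigma> \<noteq> id" and c: "c \<noteq> 0"
    and G: "algebra_automorphism (D_scale \<iota>) (D_mult \<sigma> c) G"
  obtains \<tau> b where "\<tau> \<in> Aut_over \<iota>" "\<tau> \<circ> \<sigma> = \<sigma> \<circ> \<tau>" "b \<noteq> 0" "\<tau> c = c * \<sigma> (b\<^sup>2)"
    "G = (\<lambda>(u, v). (\<tau> u, \<tau> v * b))"
proof -
  note \<sigma>D = Aut_overD[OF \<sigma>(1)]
  have bij: "bij G" and add: "\<And>p q. G (p + q) = G p + G q"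
    and scale: "\<And>a p. G (D_scale \<iota> a p) = D_scale \<iota> a (G p)"
    and mult: "\<And>p q. G (D_mult \<sigma> c p q) = D_mult \<sigma> c (G p) (G q)"
    using G by (auto simp: algebra_automorphism_def linear_D_scale_iff)
  \<comment> \<open>The equivalence is used both ways: from right to left it yields
    \<open>\<tau>\<close>, from left to right the surjectivity of \<open>\<tau>\<close> and
    \<open>b \<noteq> 0\<close>.\<close>
  have nuc: "snd (G q) = 0 \<longleftrightarrow> snd q = 0" for q
  proof -
    have "p \<in> middle_nucleus (D_mult \<sigma> c) \<longleftrightarrow> snd p = 0" for p
      by (subst middle_nucleus_D_mult) (use \<sigma>D \<sigma>(2) c in \<open>auto simp: prod_eq_iff\<close>)
    then show ?thesis
      using bij_mult_middle_nucleus_iff[of G "D_mult \<sigma> c" q, OF bij mult] by simp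
  qed
  define \<tau> where "\<tau> u = fst (G (u, 0))" for u
  have G\<tau>: "G (u, 0) = (\<tau> u, 0)" for u
    using nuc[of "(u, 0)"] by (simp add: \<tau>_def prod_eq_iff)
  have \<tau>_add: "\<tau> (x + y) = \<tau> x + \<tau> y" for x y
    using add[of "(x, 0)" "(y, 0)"] by (simp add: G\<tau>)
  have \<tau>_mult: "\<tau> (x * y) = \<tau> x * \<tau> y" for x y
    using mult[of "(x, 0)" "(y, 0)"] by (simp add: G\<tau> D_mult_def \<sigma>D)
  have "inj \<tau>"
    using bij G\<tau> by (metis (no_types, lifting) bij_is_inj injD injI prod.inject)
  have "surj \<tau>"
  \<comment> \<open>The right inverse of \<open>\<tau>\<close> is read off from
    \<open>inv G\<close>, which maps \<open>(x, 0)\<close> back into the middle nucleus.\<close>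
  proof (rule surjI)
    fix x
    obtain q where q: "G q = (x, 0)" using bij by (metis bij_pointE)
    with nuc[of q] have "q = (fst q, 0)" by (simp add: prod_eq_iff)
    with q show "\<tau> (fst (inv G (x, 0))) = x"
      using bij by (metis G\<tau> bij_inv_eq_iff fst_conv)
  qed
  have "\<tau> 1 = 1"
    using \<tau>_mult \<open>surj \<tau>\<close> by (metis mult.right_neutral mult_1 surjD)
  \<comment> \<open>\<open>(\<iota> a, 0)\<close> is the scalar \<open>a\<close> times the unit
    \<open>(1, 0)\<close>, which \<open>G\<close> fixes.\<close>
  have "\<tau> (\<iota> a) = \<iota> a" for a
    using scale[of a "(1, 0)"] by (simp add: D_scale_def G\<tau> \<open>\<tau> 1 = 1\<close>)
  then have \<tau>: "\<tau> \<in> Aut_over \<iota>"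
    using \<open>inj \<tau>\<close> \<open>surj \<tau>\<close> \<tau>_add \<tau>_mult by (simp add: Aut_over_def bij_def)
  obtain a b where ab: "G (0, 1) = (a, b)" by fastforce
  have "b \<noteq> 0"
    using nuc[of "(0, 1)"] by (simp add: ab)
  have sq: "a * a + c * \<sigma> (b * b) = \<tau> c \<and> a * b + b * a = 0"
    using mult[of "(0, 1)" "(0, 1)"]
    by (simp add: ab G\<tau> D_mult_def \<sigma>D)
  then have "2 * (a * b) = 0" by (simp add: mult.commute)
  then have "a = 0"
    using two_neq_0[OF char] \<open>b \<noteq> 0\<close> by simp
  have \<tau>c: "\<tau> c = c * \<sigma> (b\<^sup>2)"
    using sq \<open>a = 0\<close> by (simp add: power2_eq_square)
  \<comment> \<open>Here \<open>(0, v)\<close> is the product of \<open>(v, 0)\<close> and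
    \<open>(0, 1)\<close>.\<close>
  have G0: "G (0, v) = (0, \<tau> v * b)" for v
    using mult[of "(v, 0)" "(0, 1)"] by (simp add: ab \<open>a = 0\<close> G\<tau> D_mult_def \<sigma>D)
  have "G (u, v) = (\<tau> u, \<tau> v * b)" for u v
    using add[of "(u, 0)" "(0, v)"] by (simp add: G\<tau> G0)
  then have "G = (\<lambda>(u, v). (\<tau> u, \<tau> v * b))" by auto
  moreover have "\<tau> (\<sigma> v) = \<sigma> (\<tau> v)" for v
  proof -
    have "\<tau> c * \<tau> (\<sigma> v) = c * \<sigma> (b\<^sup>2) * \<sigma> (\<tau> v)"
      using mult[of "(0, v)" "(0, 1)"]
      by (simp add: ab \<open>a = 0\<close> G\<tau> G0 D_mult_def \<sigma>D \<tau>_mult \<open>\<tau> 1 = 1\<close> power2_eq_square mult_ac)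
    \<comment> \<open>The common factor \<open>\<tau> c = c * \<sigma> (b\<^sup>2)\<close> is
      nonzero and cancels.\<close>
    then show ?thesis using \<tau>c c \<open>b \<noteq> 0\<close> \<sigma>D(6) by simp
  qed
  then have "\<tau> \<circ> \<sigma> = \<sigma> \<circ> \<tau>" by auto
  ultimately show thesis using that \<tau> \<open>b \<noteq> 0\<close> \<tau>c by blast
qed

end

theorem theorem2p22:
  fixes \<iota> :: "'f::field \<Rightarrow> 'k::field" and \<sigma> :: "'k \<Rightarrow> 'k" and c :: 'k
    and G :: "'k \<times> 'k \<Rightarrow> 'k \<times> 'k"
  assumes "CHAR('f) \<noteq> 2"
    and "finite_field_extension \<iota>"
    and "\<sigma> \<in> Aut_over \<iota>" and "\<sigma> \<noteq> id"
    and "c \<noteq> 0"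
  shows "algebra_automorphism (D_scale \<iota>) (D_mult \<sigma> c) G \<longleftrightarrow>
    (\<exists>\<tau> b. \<tau> \<in> Aut_over \<iota> \<and> \<tau> \<circ> \<sigma> = \<sigma> \<circ> \<tau> \<and> b \<noteq> 0 \<and> \<tau> c = c * \<sigma> (b^2) \<and>
       G = (\<lambda>(u, v). (\<tau> u, \<tau> v * b)))"
proof -
  interpret finite_field_extension \<iota> by fact
  show ?thesis
    using algebra_automorphism_imp[OF assms(1,3-5), of G] algebra_automorphism_if[OF assms(3)]
    by blast
qed

end
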